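(* Let $(x^k,y^k,u^k)$ be generated by Algorithm (DFG) and let $\hat u^k=\sum_{j=0}^k\frac{\theta_j}{S_k^\theta}u^j$ with $S_k^\theta=\sum_{j=0}^k\theta_j$ and $\theta_0=0$. Then the average primal iterate $\hat u^k$ is an $\epsilon$-primal solution of (P) after $k=\mathcal{O}(1/\sqrt\epsilon)$ iterations; that is, there exist constants $C_1,C_2>0$, independent of $\epsilon$ and $k$, such that for every $\epsilon>0$ and every integer $k\ge1$ with $k\ge C_1/\sqrt\epsilon$, $$\mathrm{dist}_{\mathcal{K}}(G\hat u^k+g)\le C_2\,\epsilon \quad\text{and}\quad -C_2\,\epsilon\le f(\hat u^k)-f^*\le C_2\,\epsilon .$$
   Context: Problem (P): $f^* = \min_{u \in U} f(u)$ subject to $Gu + g \in \mathcal{K}$, where $f:\mathbb{R}^n \to \mathbb{R}$ is $\sigma_{\mathrm f}$-strongly convex with respect to the Euclidean norm $\|\cdot\|$ ($\sigma_{\mathrm f}>0$), $G \in \mathbb{R}^{p\times n}$ ($G\ne 0$), $g \in \mathbb{R}^p$, $\mathcal{K}\subseteq\mathbb{R}^p$ is a proper cone (closed, convex, pointed, nonempty interior), and $U \subseteq \mathbb{R}^n$ is a nonempty closed convex set. $\mathcal{K}^* = \{x : \langle x,z\rangle \ge 0\ \forall z\in\mathcal{K}\}$ is the dual cone. The Lagrangian is $\mathcal{L}(u,x) = f(u) - \langle x, Gu+g\rangle$, the dual function is $d(x) = \min_{u\in U}\mathcal{L}(u,x)$ for $x \in \mathbb{R}^p$, and $u(x)$ is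 the unique minimizer of $\mathcal{L}(\cdot,x)$ over $U$. The function $d$ is concave and differentiable on $\mathbb{R}^p$ with $\nabla d(x) = -Gu(x)-g$, Lipschitz with constant $L_{\mathrm d} = \|G\|^2/\sigma_{\mathrm f}$ ($\|G\|$ the spectral norm). Standing assumption: there exists a finite optimal Lagrange multiplier for the conic constraint, so that $f^* = \max_{x\in\mathcal{K}^*} d(x)$ and the set $X^*\subseteq\mathcal{K}^*$ of maximizers is nonempty. $[z]_C$ denotes Euclidean projection onto $C$ and $\mathrm{dist}_C(z)=\min_{w\in C}\|w-z\|$. Algorithm (DFG): given $x^0=y^1\in\mathcal{K}^*$ and $\theta_1=1$, for $k\ge1$ compute $u^k=u(y^k)=\arg\min_{u\in U}\mathcal{L}(u,y^k)$, $x^k=\left[y^k+\frac{1}{L_{\mathrm d}}\nabla d(y^k)\right]_{\mathcal{K}^*}$, $\theta_{k+1}=\frac{1+\sqrt{1+4\theta_k^2}}{2}$, and $y^{k+1}=x^k+\frac{\theta_k-1}{\theta_{k+1}}(x^k-x^{k-1})$. By convention $\theta_0=0$, so the $j=0$ term of the average vanishes (whatever $u^0$ is). $\tilde u\in U$ is an $\epsilon$-primal solution if $\mathrm{dist}_{\mathcal{K}}(G\tilde u+g)\le\mathcal{O}(\epsilon)$ and $-\mathcal{O}(\epsilon)\le f(\tilde u)-f^*\le\mathcal{O}(\epsilon)$; constants in $\mathcal{O}$ may depend on the problem data and $x^0$, but not on $\epsilon$ or $k$. *)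

theory Defs
  imports "HOL-Analysis.Analysis"
begin

definition strongly_convex_with :: "real \<Rightarrow> ('a::real_normed_vector \<Rightarrow> real) \<Rightarrow> bool" where
  "strongly_convex_with \<sigma> f \<longleftrightarrow>
     (\<forall>x y t. 0 \<le> t \<and> t \<le> 1 \<longrightarrow>
        f (t *\<^sub>R x + (1 - t) *\<^sub>R y)
          \<le> t * f x + (1 - t) * f y - \<sigma> / 2 * t * (1 - t) * (norm (x - y))\<^sup>2)"

definition proper_cone :: "'a::euclidean_space set \<Rightarrow> bool" where
  "proper_cone K \<longleftrightarrow>
     convex_cone K \<and> closed K \<and> (\<forall>z. z \<in> K \<and> - z \<in> K \<longrightarrow> z = 0) \<and> interior K \<noteq> {}"

definition dual_cone :: "'a::real_inner set \<Rightarrow> 'a set" where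
  "dual_cone K = {x. \<forall>z\<in>K. 0 \<le> x \<bullet> z}"

definition gradient :: "('a::real_inner \<Rightarrow> real) \<Rightarrow> 'a \<Rightarrow> 'a" where
  "gradient h x = (THE D. GDERIV h x :> D)"

definition feasible_set ::
  "real^'n^'p \<Rightarrow> real^'p \<Rightarrow> (real^'p) set \<Rightarrow> (real^'n) set \<Rightarrow> (real^'n) set" where
  "feasible_set G g K U = {u \<in> U. G *v u + g \<in> K}"

text \<open>The minima in the next definition and in \<open>dual_function\<close> are written as infima; for
  strongly convex \<open>f\<close> and closed nonempty constraint sets they are attained.\<close>

definition primal_value ::
  "(real^'n \<Rightarrow> real) \<Rightarrow> real^'n^'p \<Rightarrow> real^'p \<Rightarrow> (real^'p) set \<Rightarrow> (real^'n) set \<Rightarrow> real" where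
  "primal_value f G g K U = (INF u\<in>feasible_set G g K U. f u)"

definition lagrangian ::
  "(real^'n \<Rightarrow> real) \<Rightarrow> real^'n^'p \<Rightarrow> real^'p \<Rightarrow> real^'n \<Rightarrow> real^'p \<Rightarrow> real" where
  "lagrangian f G g u x = f u - x \<bullet> (G *v u + g)"

definition dual_function ::
  "(real^'n \<Rightarrow> real) \<Rightarrow> real^'n^'p \<Rightarrow> real^'p \<Rightarrow> (real^'n) set \<Rightarrow> real^'p \<Rightarrow> real" where
  "dual_function f G g U x = (INF u\<in>U. lagrangian f G g u x)"

definition lagrangian_minimizer ::
  "(real^'n \<Rightarrow> real) \<Rightarrow> real^'n^'p \<Rightarrow> real^'p \<Rightarrow> (real^'n) set \<Rightarrow> real^'p \<Rightarrow> real^'n" where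
  "lagrangian_minimizer f G g U x = arg_min_on (\<lambda>u. lagrangian f G g u x) U"

definition dual_optimal_set ::
  "(real^'n \<Rightarrow> real) \<Rightarrow> real^'n^'p \<Rightarrow> real^'p \<Rightarrow> (real^'p) set \<Rightarrow> (real^'n) set \<Rightarrow> (real^'p) set" where
  "dual_optimal_set f G g K U =
     {x \<in> dual_cone K. \<forall>z\<in>dual_cone K. dual_function f G g U z \<le> dual_function f G g U x}"

text \<open>The operator norm of \<open>(*v) G\<close> for the Euclidean norms is the spectral norm of \<open>G\<close>.\<close>

definition dual_lipschitz :: "real \<Rightarrow> real^'n^'p \<Rightarrow> real" where
  "dual_lipschitz \<sigma> G = (onorm ((*v) G))\<^sup>2 / \<sigma>"

fun theta :: "nat \<Rightarrow> real" where
  "theta 0 = 0"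
| "theta (Suc 0) = 1"
| "theta (Suc (Suc k)) = (1 + sqrt (1 + 4 * (theta (Suc k))\<^sup>2)) / 2"

text \<open>\<open>dfg_iterates f \<sigma> G g K U x0 x y u\<close>: the sequences \<open>x\<close>, \<open>y\<close>, \<open>u\<close> are generated by the dual
  fast gradient method started at \<open>x0\<close>.  The entries \<open>y 0\<close> and \<open>u 0\<close> are left arbitrary.\<close>

definition dfg_iterates ::
  "(real^'n \<Rightarrow> real) \<Rightarrow> real \<Rightarrow> real^'n^'p \<Rightarrow> real^'p \<Rightarrow> (real^'p) set \<Rightarrow> (real^'n) set \<Rightarrow> real^'p \<Rightarrow>
   (nat \<Rightarrow> real^'p) \<Rightarrow> (nat \<Rightarrow> real^'p) \<Rightarrow> (nat \<Rightarrow> real^'n) \<Rightarrow> bool" where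
  "dfg_iterates f \<sigma> G g K U x0 x y u \<longleftrightarrow>
     x 0 = x0 \<and> y 1 = x0 \<and>
     (\<forall>k\<ge>1.
        u k = lagrangian_minimizer f G g U (y k) \<and>
        x k = closest_point (dual_cone K)
                (y k + (1 / dual_lipschitz \<sigma> G) *\<^sub>R gradient (dual_function f G g U) (y k)) \<and>
        y (k + 1) = x k + ((theta k - 1) / theta (k + 1)) *\<^sub>R (x k - x (k - 1)))"

definition theta_sum :: "nat \<Rightarrow> real" where
  "theta_sum k = (\<Sum>j=0..k. theta j)"

definition average_iterate :: "(nat \<Rightarrow> real^'n) \<Rightarrow> nat \<Rightarrow> real^'n" where
  "average_iterate u k = (\<Sum>j=0..k. (theta j / theta_sum k) *\<^sub>R u j)"

end

theory Submission
  imports Defs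
begin

text \<open>
  The method is an accelerated projected gradient method applied to the dual function \<open>d\<close>.  Strong
  convexity of \<open>f\<close> makes the minimiser \<open>u(x)\<close> of the Lagrangian unique and Lipschitz in \<open>x\<close>, so \<open>d\<close>
  is squeezed between its linearisation and the linearisation minus \<open>L / 2\<close> times the squared
  distance (\<open>dual_ge_linearisation\<close>); this also yields the gradient of \<open>d\<close>.

  The observation that links dual and primal iterates is that the linearisation of \<open>d\<close> at \<open>y\<^sup>j\<close> is
  exactly the Lagrangian \<open>L(u\<^sup>j, \<cdot>)\<close>.  The usual potential argument for acceleration therefore need
  not discard the linearisations: summed over the iterations, with \<open>S = \<theta>\<^sub>1 + \<dots> + \<theta>\<^sub>k = \<theta>\<^sub>k\<^sup>2\<close>, it
  gives, for every multiplier \<open>z\<close> in the dual cone,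
  \<open>\<theta>\<^sub>1 L(u\<^sup>1, z) + \<dots> + \<theta>\<^sub>k L(u\<^sup>k, z) \<le> S d(x\<^sup>k) + L / 2 * (norm (z - x\<^sup>0))\<^sup>2\<close> (\<open>dfg_potential\<close>).  By
  convexity the left-hand side dominates \<open>S\<close> times the Lagrangian at the averaged primal point \<open>v\<close>,
  so that \<open>L(v, z)\<close> exceeds the optimal value \<open>d(x\<^sup>*)\<close> by at most
  \<open>L / (2 S) * (norm (z - x\<^sup>0))\<^sup>2\<close> (\<open>average_lagrangian_bound\<close>).

  All primal estimates come from a choice of \<open>z\<close> (\<open>dfg_primal_gap\<close>).  For \<open>z = 0\<close> the Lagrangian is
  \<open>f\<close>, which bounds the objective from above.  For \<open>z = x\<^sup>*\<close> shifted by a unit vector along the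
  violation of the conic constraint, comparison with \<open>d(x\<^sup>*) \<le> L(v, x\<^sup>*)\<close> bounds the violation.  The
  lower bound on the objective follows from \<open>d(x\<^sup>*) \<le> L(v, x\<^sup>*)\<close> and the bound on the violation.
  Since \<open>\<theta>\<^sub>k \<ge> k / 2\<close>, all errors are of order \<open>1 / k\<^sup>2\<close>.
\<close>

section \<open>Minimising strongly convex functions\<close>

lemma strongly_convex_with_imp_convex_on:
  fixes h :: "'a::real_normed_vector \<Rightarrow> real"
  assumes "strongly_convex_with \<sigma> h" and "\<sigma> \<ge> 0"
  shows "convex_on UNIV h"
proof (rule convex_onI)
  fix t :: real and x y :: 'a
  assume t: "0 < t" "t < 1"
  have "h (t *\<^sub>R y + (1 - t) *\<^sub>R x)
      \<le> t * h y + (1 - t) * h x - \<sigma> / 2 * t * (1 - t) * (norm (y - x))\<^sup>2"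
    using assms(1) t unfolding strongly_convex_with_def by simp
  moreover have "0 \<le> \<sigma> / 2 * t * (1 - t) * (norm (y - x))\<^sup>2"
    using assms(2) t by simp
  ultimately show "h ((1 - t) *\<^sub>R x + t *\<^sub>R y) \<le> (1 - t) * h x + t * h y"
    by (simp add: add.commute)
qed simp

text \<open>Along the ray from \<open>u0\<close> through \<open>u\<close>, strong convexity bounds \<open>h\<close> from below by a quadratic
  whose linear part is controlled by the minimum of \<open>h\<close> on the unit ball around \<open>u0\<close>.  Hence \<open>h\<close>
  exceeds \<open>h u0\<close> outside a large ball, and compactness of the remaining part of \<open>U\<close> suffices.\<close>

lemma strongly_convex_attains_min:
  fixes h :: "'a::euclidean_space \<Rightarrow> real"
  assumes sc: "strongly_convex_with \<sigma> h" and \<sigma>: "\<sigma> > 0"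
    and U: "closed U" "U \<noteq> {}"
  obtains m where "m \<in> U" and "\<And>u. u \<in> U \<Longrightarrow> h m \<le> h u"
proof -
  obtain u0 where u0: "u0 \<in> U" using U by blast
  have cont: "continuous_on S h" for S
    using convex_on_continuous[OF open_UNIV strongly_convex_with_imp_convex_on[OF sc]] \<sigma>
      continuous_on_subset by fastforce
  obtain b where b: "\<And>v. v \<in> cball u0 1 \<Longrightarrow> h b \<le> h v"
    using continuous_attains_inf[OF compact_cball _ cont, of u0 1] by fastforce
  \<comment> \<open>Along a ray of length \<open>r\<close> the linear loss is at most \<open>r * (h u0 - h b)\<close> and the quadratic gain
    is \<open>\<sigma> / 2 * r * (r - 1)\<close>; they balance at \<open>r = R\<close>.\<close>
  define R where "R = 1 + 2 * (h u0 - h b) / \<sigma>"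
  have hb: "h b \<le> h u0" using b by simp
  then have R1: "R \<ge> 1" unfolding R_def using \<sigma> by simp
  have far: "h u0 \<le> h u" if "norm (u - u0) > R" for u
  proof -
    define r where "r = norm (u - u0)"
    have r: "r > R" "r > 1" using that R1 unfolding r_def by linarith+
    define v where "v = (1 / r) *\<^sub>R u + (1 - 1 / r) *\<^sub>R u0"
    have "v - u0 = (1 / r) *\<^sub>R (u - u0)" unfolding v_def by (simp add: algebra_simps)
    then have "norm (v - u0) = 1" using r unfolding r_def by auto
    then have "h b \<le> h v" using b by (simp add: dist_norm norm_minus_commute)
    also have "h v \<le> (1 / r) * h u + (1 - 1 / r) * h u0 - \<sigma> / 2 * (1 / r) * (1 - 1 / r) * r\<^sup>2"
      using sc[unfolded strongly_convex_with_def, rule_format, of "1 / r" u u0] r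
      unfolding v_def r_def[symmetric] by simp
    also have "\<dots> = (h u + (r - 1) * h u0 - \<sigma> / 2 * (r - 1) * r) / r"
      using r by (simp add: field_simps power2_eq_square)
    finally have "r * h b \<le> h u + (r - 1) * h u0 - \<sigma> / 2 * (r - 1) * r"
      using r by (simp add: field_simps)
    moreover have "r * (h u0 - h b) \<le> r * (\<sigma> / 2 * (r - 1))"
      using r \<sigma> unfolding R_def by (intro mult_left_mono) (auto simp: field_simps)
    moreover have "r * (h u0 - h b) = r * h u0 - r * h b" "(r - 1) * h u0 = r * h u0 - h u0"
      "r * (\<sigma> / 2 * (r - 1)) = \<sigma> / 2 * (r - 1) * r"
      by (simp_all add: algebra_simps)
    ultimately show ?thesis by linarith
  qed
  have "compact (U \<inter> cball u0 R)" using U by (simp add: closed_Int_compact)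
  moreover have "u0 \<in> U \<inter> cball u0 R" using u0 R1 by simp
  ultimately obtain m where m: "m \<in> U" and min: "\<And>v. v \<in> U \<inter> cball u0 R \<Longrightarrow> h m \<le> h v"
    using continuous_attains_inf[OF _ _ cont, of "U \<inter> cball u0 R"] by fastforce
  show ?thesis
  proof (rule that[OF m])
    fix u assume u: "u \<in> U"
    show "h m \<le> h u"
    proof (cases "norm (u - u0) \<le> R")
      case True
      then show ?thesis using min u by (simp add: dist_norm norm_minus_commute)
    next
      case False
      then show ?thesis
        using far[of u] min[OF \<open>u0 \<in> U \<inter> cball u0 R\<close>] by linarith
    qed
  qed
qed

text \<open>This is minimality of \<open>m\<close> against the points \<open>t u + (1 - t) m\<close>, divided by \<open>t\<close>, in the limit
  \<open>t \<rightarrow> 0\<close>.\<close>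

lemma strongly_convex_quadratic_growth:
  fixes h :: "'a::real_normed_vector \<Rightarrow> real"
  assumes sc: "strongly_convex_with \<sigma> h"
    and "convex U" "m \<in> U" "u \<in> U" and min: "\<And>v. v \<in> U \<Longrightarrow> h m \<le> h v"
  shows "h m + \<sigma> / 2 * (norm (u - m))\<^sup>2 \<le> h u"
proof -
  define c where "c = \<sigma> / 2 * (norm (u - m))\<^sup>2"
  have ineq: "h m + (1 - t) * c \<le> h u" if t: "0 < t" "t < 1" for t
  proof -
    have "h m \<le> h (t *\<^sub>R u + (1 - t) *\<^sub>R m)"
      using t assms by (intro min) (simp add: convex_alt add.commute)
    also have "\<dots> \<le> t * h u + (1 - t) * h m - \<sigma> / 2 * t * (1 - t) * (norm (u - m))\<^sup>2"
      using sc t unfolding strongly_convex_with_def by simp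
    finally have "t * (h m + (1 - t) * c) \<le> t * h u"
      unfolding c_def by (simp add: algebra_simps)
    then show ?thesis using t by simp
  qed
  have "((\<lambda>t. h m + (1 - t) * c) \<longlongrightarrow> h m + (1 - 0) * c) (at_right 0)"
    by (intro tendsto_intros)
  moreover have "eventually (\<lambda>t. h m + (1 - t) * c \<le> h u) (at_right 0)"
    unfolding eventually_at_right_field using ineq by (intro exI[of _ 1]) auto
  ultimately have "h m + (1 - 0) * c \<le> h u"
    by (intro tendsto_upperbound) auto
  then show ?thesis unfolding c_def by simp
qed

section \<open>Dual cones and projections\<close>

lemma dual_cone_zero: "0 \<in> dual_cone K"
  by (simp add: dual_cone_def)

lemma dual_cone_add_scaleR:
  "x \<in> dual_cone K \<Longrightarrow> y \<in> dual_cone K \<Longrightarrow> 0 \<le> s \<Longrightarrow> 0 \<le> t \<Longrightarrow> s *\<^sub>R x + t *\<^sub>R y \<in> dual_cone K"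
  by (simp add: dual_cone_def inner_left_distrib)

lemma convex_dual_cone: "convex (dual_cone K)"
  by (simp add: convex_def dual_cone_add_scaleR)

lemma closed_dual_cone: "closed (dual_cone K)"
proof -
  have "dual_cone K = (\<Inter>z\<in>K. {x. 0 \<le> x \<bullet> z})" by (auto simp: dual_cone_def)
  moreover have "closed {x. 0 \<le> x \<bullet> z}" for z :: 'a
    by (intro closed_Collect_le continuous_intros)
  ultimately show ?thesis by auto
qed

text \<open>Moreau's decomposition of \<open>w\<close>, with \<open>p\<close> the projection of \<open>w\<close> onto \<open>K\<close> and \<open>r\<close> the
  projection of \<open>- w\<close> onto the dual cone.\<close>

lemma cone_dual_decomposition:
  fixes K :: "'a::euclidean_space set"
  assumes K: "convex_cone K" "closed K"
  obtains p r where "w = p - r" "p \<in> K" "r \<in> dual_cone K" "r \<bullet> p = 0" "infdist w K = norm r"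
proof -
  have ne: "K \<noteq> {}" and cv: "convex K"
    and sc: "\<And>c z. z \<in> K \<Longrightarrow> 0 \<le> c \<Longrightarrow> c *\<^sub>R z \<in> K"
    and add: "\<And>z z'. z \<in> K \<Longrightarrow> z' \<in> K \<Longrightarrow> z + z' \<in> K"
    using K(1) convex_cone_add[OF K(1)] by (auto simp: convex_cone_def conic_def)
  define p where "p = closest_point K w"
  define r where "r = p - w"
  have p: "p \<in> K" unfolding p_def using K(2) ne by (rule closest_point_in_set)
  have opt: "0 \<le> r \<bullet> (z - p)" if "z \<in> K" for z
    using closest_point_dot[OF cv K(2) that, of w]
    unfolding r_def p_def by (simp add: inner_diff_left)
  have r: "r \<in> dual_cone K"
    unfolding dual_cone_def using opt[OF add[OF _ p]] by simp
  have "0 \<le> r \<bullet> (0 *\<^sub>R p - p)" by (intro opt sc p) simp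
  moreover have "0 \<le> r \<bullet> (2 *\<^sub>R p - p)" by (intro opt sc p) simp
  ultimately have orth: "r \<bullet> p = 0" by (simp add: inner_diff_right)
  have "infdist w K = dist w p"
    unfolding p_def using closest_point_le[OF K(2)] closest_point_in_set[OF K(2) ne] ne
    by (intro antisym infdist_le) (auto simp: infdist_def intro!: cINF_greatest)
  then have "infdist w K = norm r" unfolding r_def by (simp add: dist_norm norm_minus_commute)
  with p r orth show ?thesis by (intro that[of p r]) (auto simp: r_def)
qed

text \<open>The projected gradient step maximises over \<open>C\<close> the model
  \<open>z \<mapsto> q \<bullet> (z - y) - L / 2 * (norm (z - y))\<^sup>2\<close>, which is \<open>L\<close>-strongly concave; the right-hand
  side is its value at \<open>z\<close> plus the resulting quadratic gap.\<close>

lemma projected_step_three_point: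
  fixes C :: "'a::euclidean_space set"
  assumes "convex C" "closed C" "z \<in> C" "L > 0"
    and x: "x = closest_point C (y + (1 / L) *\<^sub>R q)"
  shows "q \<bullet> (x - y) - L / 2 * (norm (x - y))\<^sup>2
    \<ge> q \<bullet> (z - y) - L / 2 * (norm (z - y))\<^sup>2 + L / 2 * (norm (z - x))\<^sup>2"
proof -
  have "(y + (1 / L) *\<^sub>R q - x) \<bullet> (z - x) \<le> 0"
    unfolding x using assms by (intro closest_point_dot)
  then have "L * ((y - x) \<bullet> (z - x) + (1 / L) * (q \<bullet> (z - x))) \<le> L * 0"
    using \<open>L > 0\<close> by (intro mult_left_mono) (auto simp: inner_diff_left inner_add_left)
  then have 1: "q \<bullet> (z - x) \<le> L * ((x - y) \<bullet> (z - x))"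
    using \<open>L > 0\<close> by (simp add: algebra_simps)
  have "(norm (a + b))\<^sup>2 = (norm a)\<^sup>2 + (norm b)\<^sup>2 + 2 * (b \<bullet> a)" for a b :: 'a
    by (simp add: power2_norm_eq_inner inner_add_left inner_add_right inner_commute)
  from this[of "z - x" "x - y"]
  have "(norm (z - y))\<^sup>2 = (norm (z - x))\<^sup>2 + (norm (x - y))\<^sup>2 + 2 * ((x - y) \<bullet> (z - x))"
    by simp
  then have "L / 2 * (norm (z - y))\<^sup>2
      = L / 2 * (norm (z - x))\<^sup>2 + L / 2 * (norm (x - y))\<^sup>2 + L * ((x - y) \<bullet> (z - x))"
    by (simp add: distrib_left)
  moreover have "q \<bullet> (z - y) = q \<bullet> (z - x) + q \<bullet> (x - y)" by (simp add: inner_diff_right)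
  ultimately show ?thesis using 1 by linarith
qed

section \<open>The momentum parameters\<close>

lemma theta_recurrence: "(theta (Suc k))\<^sup>2 - theta (Suc k) = (theta k)\<^sup>2"
proof (cases k)
  case (Suc j)
  have "(sqrt (1 + 4 * (theta (Suc j))\<^sup>2))\<^sup>2 = 1 + 4 * (theta (Suc j))\<^sup>2" by simp
  then show ?thesis unfolding Suc by (simp add: power2_eq_square field_simps)
qed simp

lemma theta_lower_bound: "theta (Suc k) \<ge> (real k + 2) / 2"
proof (induction k)
  case (Suc k)
  have "2 * theta (Suc k) \<le> sqrt (1 + 4 * (theta (Suc k))\<^sup>2)"
    by (intro real_le_rsqrt) (simp add: power_mult_distrib)
  with Suc show ?case by simp
qed simp

lemma theta_Suc_ge_one: "theta (Suc k) \<ge> 1"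
  by (rule order_trans[OF _ theta_lower_bound]) simp

lemma theta_nonneg: "theta k \<ge> 0"
  using theta_Suc_ge_one[of "k - 1"] by (cases k) auto

lemma theta_sum_eq: "theta_sum k = (theta k)\<^sup>2"
proof (induction k)
  case (Suc k)
  then show ?case using theta_recurrence[of k] by (simp add: theta_sum_def)
qed (simp add: theta_sum_def)

section \<open>The dual function\<close>

locale strongly_convex_lagrangian =
  fixes f :: "real^'n \<Rightarrow> real" and \<sigma> :: real
    and G :: "real^'n^'p" and g :: "real^'p" and U :: "(real^'n) set"
  assumes sigma_pos: "\<sigma> > 0" and strongly_convex: "strongly_convex_with \<sigma> f"
    and G_nonzero: "G \<noteq> 0"
    and U_nonempty: "U \<noteq> {}" and closed_U: "closed U" and convex_U: "convex U"
begin

abbreviation "lagr \<equiv> lagrangian f G g"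
abbreviation "dual \<equiv> dual_function f G g U"
abbreviation "minimizer \<equiv> lagrangian_minimizer f G g U"
abbreviation "residual u \<equiv> G *v u + g"
abbreviation "Ld \<equiv> dual_lipschitz \<sigma> G"

lemma Ld_pos: "Ld > 0"
proof -
  have "(*v) G \<noteq> (\<lambda>x. 0)"
    using G_nonzero by (metis matrix_eq matrix_vector_mult_0)
  then have "onorm ((*v) G) \<noteq> 0"
    using onorm_eq_0[OF matrix_vector_mul_bounded_linear] by metis
  then show ?thesis using sigma_pos by (simp add: dual_lipschitz_def)
qed

lemma lagrangian_strongly_convex: "strongly_convex_with \<sigma> (\<lambda>u. lagr u x)"
proof -
  have "x \<bullet> residual (t *\<^sub>R u + (1 - t) *\<^sub>R v) = t * (x \<bullet> residual u) + (1 - t) * (x \<bullet> residual v)"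
    for u v t
    by (simp add: matrix_vector_right_distrib matrix_vector_mult_scaleR inner_add_right
        inner_diff_right algebra_simps)
  then show ?thesis
    using strongly_convex unfolding strongly_convex_with_def lagrangian_def
    by (auto simp: algebra_simps)
qed

lemma
  shows minimizer_in: "minimizer x \<in> U"
    and minimizer_le: "u \<in> U \<Longrightarrow> lagr (minimizer x) x \<le> lagr u x"
proof -
  obtain m where "m \<in> U" "\<And>u. u \<in> U \<Longrightarrow> lagr m x \<le> lagr u x"
    using strongly_convex_attains_min[OF lagrangian_strongly_convex sigma_pos closed_U U_nonempty]
    by blast
  then have "is_arg_min (\<lambda>u. lagr u x) (\<lambda>u. u \<in> U) m"
    by (auto simp: is_arg_min_linorder)
  then have "is_arg_min (\<lambda>u. lagr u x) (\<lambda>u. u \<in> U) (minimizer x)"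
    unfolding lagrangian_minimizer_def arg_min_on_def arg_min_def by (rule someI)
  then show "minimizer x \<in> U" "u \<in> U \<Longrightarrow> lagr (minimizer x) x \<le> lagr u x"
    by (auto simp: is_arg_min_linorder)
qed

lemma dual_eq: "dual x = lagr (minimizer x) x"
  unfolding dual_function_def
  using minimizer_in minimizer_le by (intro cInf_eq_minimum) auto

lemma dual_le: "u \<in> U \<Longrightarrow> dual x \<le> lagr u x"
  using dual_eq minimizer_le by simp

text \<open>The linearisation of the dual function at \<open>y\<close> is \<open>lagr (minimizer y)\<close>.  Moving the multiplier
  from \<open>y\<close> to \<open>z\<close> can lower the value below this linearisation only by moving the minimiser, and
  quadratic growth makes that cost \<open>\<sigma> / 2\<close> times the squared displacement.  The gain is at most
  the displacement times \<open>onorm ((*v) G) * norm (z - y)\<close>; the best trade-off leaves the quadratic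
  with constant \<open>Ld\<close>.\<close>

lemma dual_ge_linearisation:
  "dual z \<ge> lagr (minimizer y) z - Ld / 2 * (norm (z - y))\<^sup>2"
proof -
  let ?a = "norm (minimizer z - minimizer y)" and ?b = "norm (z - y)" and ?N = "onorm ((*v) G)"
  have "(z - y) \<bullet> (G *v (minimizer z - minimizer y)) \<le> ?b * norm (G *v (minimizer z - minimizer y))"
    by (rule norm_cauchy_schwarz)
  also have "\<dots> \<le> ?b * (?N * ?a)"
    by (intro mult_left_mono onorm matrix_vector_mul_bounded_linear) simp
  also have "\<dots> \<le> \<sigma> / 2 * ?a\<^sup>2 + Ld / 2 * ?b\<^sup>2"
  proof -
    have "0 \<le> (\<sigma> * ?a - ?N * ?b)\<^sup>2 / (2 * \<sigma>)" using sigma_pos by simp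
    also have "\<dots> = \<sigma> / 2 * ?a\<^sup>2 + Ld / 2 * ?b\<^sup>2 - ?b * (?N * ?a)"
      using sigma_pos unfolding dual_lipschitz_def by (simp add: field_simps power2_eq_square)
    finally show ?thesis by simp
  qed
  finally have coupling:
    "(z - y) \<bullet> (G *v (minimizer z - minimizer y)) \<le> \<sigma> / 2 * ?a\<^sup>2 + Ld / 2 * ?b\<^sup>2" .
  have "lagr (minimizer y) y + \<sigma> / 2 * ?a\<^sup>2 \<le> lagr (minimizer z) y"
    by (rule strongly_convex_quadratic_growth[OF lagrangian_strongly_convex convex_U])
      (auto simp: minimizer_in minimizer_le)
  moreover have "lagr (minimizer z) z - lagr (minimizer y) z
      = lagr (minimizer z) y - lagr (minimizer y) y - (z - y) \<bullet> (G *v (minimizer z - minimizer y))"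
    by (simp add: lagrangian_def matrix_vector_mult_diff_distrib inner_diff_left inner_diff_right
        inner_add_right)
  ultimately show ?thesis using coupling dual_eq[of z] by linarith
qed

lemma lagrangian_shift: "lagr u z = lagr u y + (- residual u) \<bullet> (z - y)"
  by (simp add: lagrangian_def inner_diff_right inner_add_left inner_add_right inner_commute)

text \<open>The dual function lies between its linearisation and the linearisation minus a quadratic.\<close>

lemma dual_has_gradient: "GDERIV dual y :> - residual (minimizer y)"
proof -
  let ?q = "- residual (minimizer y)"
  have bound: "\<bar>dual z - dual y - (z - y) \<bullet> ?q\<bar> \<le> Ld / 2 * (norm (z - y))\<^sup>2" for z
    using dual_ge_linearisation[of y z] dual_le[OF minimizer_in, of z y] dual_eq[of y]
      lagrangian_shift[of "minimizer y" z y] inner_commute[of ?q "z - y"] Ld_pos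
    by (simp add: abs_le_iff)
  have "((\<lambda>z. (dual z - dual y - (z - y) \<bullet> ?q) / norm (z - y)) \<longlongrightarrow> 0) (at y)"
  proof (rule Lim_null_comparison)
    show "((\<lambda>z. Ld / 2 * norm (z - y)) \<longlongrightarrow> 0) (at y)"
      by (auto intro!: tendsto_eq_intros)
    show "\<forall>\<^sub>F z in at y.
        norm ((dual z - dual y - (z - y) \<bullet> ?q) / norm (z - y)) \<le> Ld / 2 * norm (z - y)"
    proof (rule eventually_at_filter[THEN iffD2], rule always_eventually, intro allI impI)
      fix z assume "z \<noteq> y"
      then show "norm ((dual z - dual y - (z - y) \<bullet> ?q) / norm (z - y)) \<le> Ld / 2 * norm (z - y)"
        using bound[of z]
        by (simp add: norm_divide divide_le_eq power2_eq_square mult.assoc del: minus_add_distrib)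
    qed
  qed
  then show ?thesis
    unfolding gderiv_def has_derivative_at_within
    by (simp only: bounded_linear_inner_left divide_inverse_commute real_scaleR_def simp_thms)
qed

lemma gradient_dual: "gradient dual y = - residual (minimizer y)"
  unfolding gradient_def
proof (rule the_equality)
  fix D assume "GDERIV dual y :> D"
  then have "(\<lambda>h. h \<bullet> D) = (\<lambda>h. h \<bullet> (- residual (minimizer y)))"
    using dual_has_gradient has_derivative_unique unfolding gderiv_def by blast
  then show "D = - residual (minimizer y)"
    by (metis inner_commute vector_eq_rdot)
qed (rule dual_has_gradient)

section \<open>The accelerated method\<close>

lemma dfg_step:
  assumes C: "convex C" "closed C" "z \<in> C"
    and x: "x = closest_point C (y + (1 / Ld) *\<^sub>R gradient dual y)"
  shows "dual x \<ge> lagr (minimizer y) z + Ld / 2 * (norm (z - x))\<^sup>2 - Ld / 2 * (norm (z - y))\<^sup>2"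
  using projected_step_three_point[OF C Ld_pos x] dual_ge_linearisation[of y x]
    lagrangian_shift[of "minimizer y" x y] lagrangian_shift[of "minimizer y" z y]
  by (simp add: gradient_dual)

text \<open>The progress estimate is applied at the convex combination of the previous iterate and the
  comparison point \<open>z\<close> with weight \<open>1 / \<theta>\<close> on \<open>z\<close>.  After multiplication by \<open>\<theta>\<^sup>2\<close> the distances
  become distances from \<open>z\<close> to the extrapolated points \<open>\<theta> x - (\<theta> - 1) x'\<close> before and after the
  step.  Keeping \<open>lagr (minimizer y) z\<close> instead of its lower bound \<open>dual z\<close> retains the
  information about the primal point.\<close>

lemma dfg_potential_step:
  assumes C: "convex C" "closed C" "z \<in> C" "x' \<in> C" and \<theta>: "\<theta> \<ge> 1"
    and x: "x = closest_point C (y + (1 / Ld) *\<^sub>R gradient dual y)"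
  shows "\<theta>\<^sup>2 * dual x \<ge> (\<theta>\<^sup>2 - \<theta>) * dual x' + \<theta> * lagr (minimizer y) z
     + Ld / 2 * (norm (z - (\<theta> *\<^sub>R x - (\<theta> - 1) *\<^sub>R x')))\<^sup>2
     - Ld / 2 * (norm (z - (\<theta> *\<^sub>R y - (\<theta> - 1) *\<^sub>R x')))\<^sup>2"
proof -
  let ?m = "minimizer y"
  define c where "c = (1 - 1 / \<theta>) *\<^sub>R x' + (1 / \<theta>) *\<^sub>R z"
  have cC: "c \<in> C" unfolding c_def using C \<theta> by (intro convexD) auto
  have scale: "\<theta>\<^sup>2 * (norm (c - p))\<^sup>2 = (norm (z - (\<theta> *\<^sub>R p - (\<theta> - 1) *\<^sub>R x')))\<^sup>2" for p
  proof -
    have "\<theta> *\<^sub>R (c - p) = z - (\<theta> *\<^sub>R p - (\<theta> - 1) *\<^sub>R x')"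
      unfolding c_def using \<theta> by (simp add: scaleR_right_distrib scaleR_diff_right algebra_simps)
    then show ?thesis using \<theta> by (metis abs_norm_cancel norm_scaleR power2_abs power_mult_distrib)
  qed
  have "lagr ?m c = (1 - 1 / \<theta>) * lagr ?m x' + (1 / \<theta>) * lagr ?m z"
    unfolding lagrangian_def c_def inner_add_left inner_scaleR_left by (simp add: algebra_simps)
  then have "\<theta>\<^sup>2 * lagr ?m c
      = (\<theta>\<^sup>2 * (1 - 1 / \<theta>)) * lagr ?m x' + (\<theta>\<^sup>2 * (1 / \<theta>)) * lagr ?m z"
    by (simp only: distrib_left mult.assoc)
  also have "\<theta>\<^sup>2 * (1 - 1 / \<theta>) = \<theta>\<^sup>2 - \<theta>"
    using \<theta> by (simp add: field_simps power2_eq_square)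
  also have "\<theta>\<^sup>2 * (1 / \<theta>) = \<theta>"
    using \<theta> by (simp add: power2_eq_square)
  finally have "\<theta>\<^sup>2 * lagr ?m c = (\<theta>\<^sup>2 - \<theta>) * lagr ?m x' + \<theta> * lagr ?m z" .
  moreover have "(\<theta>\<^sup>2 - \<theta>) * dual x' \<le> (\<theta>\<^sup>2 - \<theta>) * lagr ?m x'"
    using \<theta> dual_le[OF minimizer_in] by (intro mult_left_mono) (auto simp: power2_eq_square)
  moreover have "\<theta>\<^sup>2 * (lagr ?m c + Ld / 2 * (norm (c - x))\<^sup>2 - Ld / 2 * (norm (c - y))\<^sup>2)
      \<le> \<theta>\<^sup>2 * dual x"
    using dfg_step[OF C(1,2) cC x] by (intro mult_left_mono) auto
  ultimately show ?thesis
    unfolding scale[symmetric] by (simp add: algebra_simps)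
qed

context
  fixes K :: "(real^'p) set" and x0 :: "real^'p"
    and x y :: "nat \<Rightarrow> real^'p" and u :: "nat \<Rightarrow> real^'n"
  assumes dfg: "dfg_iterates f \<sigma> G g K U x0 x y u"
    and x0: "x0 \<in> dual_cone K"
begin

lemma dfg_u: "u (Suc k) = minimizer (y (Suc k))"
  using dfg by (simp add: dfg_iterates_def)

lemma dfg_x:
  "x (Suc k) = closest_point (dual_cone K)
     (y (Suc k) + (1 / Ld) *\<^sub>R gradient dual (y (Suc k)))"
  using dfg by (simp add: dfg_iterates_def)

lemma dfg_x_in: "x k \<in> dual_cone K"
proof (cases k)
  case 0
  then show ?thesis using dfg x0 by (simp add: dfg_iterates_def)
next
  case (Suc j)
  show ?thesis
    unfolding Suc dfg_x using dual_cone_zero closed_dual_cone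
    by (intro closest_point_in_set) auto
qed

text \<open>The auxiliary sequence of the potential argument.  The gradient step is taken at the convex
  combination of \<open>x (k - 1)\<close> and \<open>extrapolated (k - 1)\<close> with weight \<open>1 / theta k\<close> on the latter, which
  is what the momentum rule for \<open>y k\<close> amounts to.  The value at \<open>0\<close> encodes \<open>y 1 = x0\<close>.\<close>

definition extrapolated :: "nat \<Rightarrow> real^'p" where
  "extrapolated k = (if k = 0 then x0 else theta k *\<^sub>R x k - (theta k - 1) *\<^sub>R x (k - 1))"

lemma extrapolated_eq:
  "theta (Suc k) *\<^sub>R y (Suc k) - (theta (Suc k) - 1) *\<^sub>R x k = extrapolated k"
proof (cases "k = 0")
  case True
  then show ?thesis using dfg by (simp add: extrapolated_def dfg_iterates_def)
next
  case False
  have y: "y (Suc k) = x k + ((theta k - 1) / theta (Suc k)) *\<^sub>R (x k - x (k - 1))"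
    using dfg False by (simp add: dfg_iterates_def)
  have "theta (Suc k) > 0" using theta_Suc_ge_one[of k] by linarith
  then have "theta (Suc k) *\<^sub>R y (Suc k)
      = theta (Suc k) *\<^sub>R x k + (theta k - 1) *\<^sub>R (x k - x (k - 1))"
    unfolding y by (simp add: scaleR_right_distrib)
  then show ?thesis using False by (simp add: extrapolated_def algebra_simps)
qed

text \<open>Since \<open>\<theta>\<^sub>k\<^sub>+\<^sub>1\<^sup>2 - \<theta>\<^sub>k\<^sub>+\<^sub>1 = \<theta>\<^sub>k\<^sup>2\<close>, the potential estimates telescope.\<close>

lemma dfg_potential:
  assumes z: "z \<in> dual_cone K"
  shows "(theta k)\<^sup>2 * dual (x k) + Ld / 2 * (norm (z - x0))\<^sup>2
    \<ge> (\<Sum>j=1..k. theta j * lagr (u j) z) + Ld / 2 * (norm (z - extrapolated k))\<^sup>2"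
proof (induction k)
  case 0
  then show ?case by (simp add: extrapolated_def)
next
  case (Suc k)
  have ext: "theta (Suc k) *\<^sub>R x (Suc k) - (theta (Suc k) - 1) *\<^sub>R x k = extrapolated (Suc k)"
    by (simp add: extrapolated_def)
  from dfg_potential_step[OF convex_dual_cone closed_dual_cone z dfg_x_in[of k]
      theta_Suc_ge_one[of k] dfg_x[of k]]
  have "(theta (Suc k))\<^sup>2 * dual (x (Suc k)) \<ge> (theta k)\<^sup>2 * dual (x k)
      + theta (Suc k) * lagr (u (Suc k)) z
      + Ld / 2 * (norm (z - extrapolated (Suc k)))\<^sup>2 - Ld / 2 * (norm (z - extrapolated k))\<^sup>2"
    unfolding theta_recurrence extrapolated_eq dfg_u[symmetric] ext .
  with Suc show ?case by simp
qed

lemma average_iterate_eq: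
  "average_iterate u k = (\<Sum>j=1..k. (theta j / (theta k)\<^sup>2) *\<^sub>R u j)"
  by (simp add: average_iterate_def theta_sum_eq sum.atLeast_Suc_atMost[of 0 k])

lemma average_weights:
  assumes "k \<ge> 1"
  shows "(\<Sum>j=1..k. theta j / (theta k)\<^sup>2) = 1"
proof -
  have "(\<Sum>j=1..k. theta j) = (theta k)\<^sup>2"
    using theta_sum_eq[of k] by (simp add: theta_sum_def sum.atLeast_Suc_atMost[of 0 k])
  moreover have "theta k \<noteq> 0" using theta_Suc_ge_one[of "k - 1"] assms by auto
  ultimately show ?thesis by (simp add: sum_divide_distrib[symmetric])
qed

lemma average_iterate_in:
  assumes "k \<ge> 1"
  shows "average_iterate u k \<in> U"
  unfolding average_iterate_eq
proof (rule convex_sum[OF _ convex_U average_weights[OF assms]])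
  fix j assume "j \<in> {1..k}"
  then show "u j \<in> U" using dfg_u[of "j - 1"] minimizer_in by auto
qed (auto simp: theta_nonneg)

text \<open>Jensen's inequality for \<open>\<lambda>u. lagr u z\<close>: the weights of the average are those of the summed
  potential estimate.\<close>

lemma average_lagrangian_bound:
  assumes k: "k \<ge> 1" and z: "z \<in> dual_cone K"
  shows "lagr (average_iterate u k) z \<le> dual (x k) + Ld / (2 * (theta k)\<^sup>2) * (norm (z - x0))\<^sup>2"
proof -
  let ?S = "(theta k)\<^sup>2"
  have "theta k > 0" using theta_Suc_ge_one[of "k - 1"] k by auto
  then have S: "?S > 0" by simp
  have "lagr (average_iterate u k) z \<le> (\<Sum>j=1..k. (theta j / ?S) * lagr (u j) z)"
    unfolding average_iterate_eq
    using k average_weights[OF k] sigma_pos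
    by (intro convex_on_sum[where C = UNIV and f = "\<lambda>u. lagr u z"]
        strongly_convex_with_imp_convex_on[OF lagrangian_strongly_convex])
      (auto simp: theta_nonneg)
  also have "\<dots> = (\<Sum>j=1..k. theta j * lagr (u j) z) / ?S"
    by (simp add: sum_divide_distrib)
  also have "\<dots> \<le> (?S * dual (x k) + Ld / 2 * (norm (z - x0))\<^sup>2) / ?S"
  proof -
    have "0 \<le> Ld / 2 * (norm (z - extrapolated k))\<^sup>2" using Ld_pos by simp
    then show ?thesis using dfg_potential[OF z, of k] S by (intro divide_right_mono) auto
  qed
  also have "\<dots> = dual (x k) + Ld / (2 * ?S) * (norm (z - x0))\<^sup>2"
    using S by (simp add: field_simps)
  finally show ?thesis .
qed

text \<open>The averaged Lagrangian bound holds for all multipliers at once.  The multiplier \<open>0\<close> gives the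
  upper bound on the objective and a shift of \<open>xs\<close> the bound on the infeasibility; weak duality at
  \<open>xs\<close> turns the latter into the lower bound on the objective.\<close>

lemma dfg_primal_gap:
  assumes k: "k \<ge> 1" and K: "convex_cone K" "closed K"
    and xs: "xs \<in> dual_optimal_set f G g K U"
  defines "\<delta> \<equiv> Ld / (2 * (theta k)\<^sup>2)" and "v \<equiv> average_iterate u k"
  shows "infdist (residual v) K \<le> \<delta> * (norm (xs - x0) + 1)\<^sup>2"
    and "f v - dual xs \<le> \<delta> * (norm x0)\<^sup>2"
    and "f v - dual xs \<ge> - (norm xs * (\<delta> * (norm (xs - x0) + 1)\<^sup>2))"
proof -
  have xsK: "xs \<in> dual_cone K" and opt: "\<And>z. z \<in> dual_cone K \<Longrightarrow> dual z \<le> dual xs"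
    using xs by (auto simp: dual_optimal_set_def)
  have \<delta>: "\<delta> \<ge> 0" unfolding \<delta>_def using Ld_pos by simp
  have upper: "lagr v z \<le> dual xs + \<delta> * (norm (z - x0))\<^sup>2" if "z \<in> dual_cone K" for z
    using average_lagrangian_bound[OF k that] opt[OF dfg_x_in[of k]]
    unfolding \<delta>_def v_def by linarith
  have lower: "dual xs \<le> lagr v xs"
    unfolding v_def by (rule dual_le[OF average_iterate_in[OF k]])
  show "f v - dual xs \<le> \<delta> * (norm x0)\<^sup>2"
    using upper[OF dual_cone_zero] by (simp add: lagrangian_def)
  obtain p r where w: "residual v = p - r" and p: "p \<in> K" and r: "r \<in> dual_cone K"
    and orth: "r \<bullet> p = 0" and dist: "infdist (residual v) K = norm r"
    using cone_dual_decomposition[OF K] by blast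
  have "norm r \<le> \<delta> * (norm (xs - x0) + 1)\<^sup>2"
  proof (cases "r = 0")
    case False
    \<comment> \<open>The multiplier \<open>z\<close> moves a unit distance from \<open>xs\<close> in the direction of the violation \<open>r\<close>,
      which raises the Lagrangian at \<open>v\<close> by exactly \<open>norm r\<close>.\<close>
    define z where "z = xs + (1 / norm r) *\<^sub>R r"
    have zK: "z \<in> dual_cone K"
      unfolding z_def using dual_cone_add_scaleR[OF xsK r, of 1 "1 / norm r"] by simp
    have "r \<bullet> residual v = - (norm r)\<^sup>2"
      unfolding w using orth by (simp add: inner_diff_right power2_norm_eq_inner)
    then have "lagr v z = lagr v xs + norm r"
      using False unfolding lagrangian_def z_def inner_add_left
      by (simp add: power2_eq_square)
    with upper[OF zK] lower have "norm r \<le> \<delta> * (norm (z - x0))\<^sup>2" by linarith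
    also have "\<dots> \<le> \<delta> * (norm (xs - x0) + 1)\<^sup>2"
    proof (intro mult_left_mono power_mono \<delta>)
      have "norm (z - x0) = norm ((xs - x0) + (1 / norm r) *\<^sub>R r)"
        unfolding z_def by (simp add: algebra_simps)
      also have "\<dots> \<le> norm (xs - x0) + norm ((1 / norm r) *\<^sub>R r)"
        by (rule norm_triangle_ineq)
      finally show "norm (z - x0) \<le> norm (xs - x0) + 1" using False by simp
    qed simp
    finally show ?thesis .
  qed (simp add: \<delta>)
  then show inf: "infdist (residual v) K \<le> \<delta> * (norm (xs - x0) + 1)\<^sup>2" using dist by simp
  have "0 \<le> xs \<bullet> p" using xsK p by (simp add: dual_cone_def)
  moreover have "xs \<bullet> r \<le> norm xs * norm r" by (rule norm_cauchy_schwarz)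
  moreover have "norm xs * norm r \<le> norm xs * (\<delta> * (norm (xs - x0) + 1)\<^sup>2)"
    using inf dist by (intro mult_left_mono) auto
  moreover have "dual xs \<le> f v - xs \<bullet> p + xs \<bullet> r"
    using lower unfolding lagrangian_def w by (simp add: inner_diff_right)
  ultimately show "f v - dual xs \<ge> - (norm xs * (\<delta> * (norm (xs - x0) + 1)\<^sup>2))" by linarith
qed

end

end

section \<open>Iteration complexity\<close>

theorem theorem4p5:
  fixes f :: "real^'n \<Rightarrow> real" and \<sigma> :: real
    and G :: "real^'n^'p" and g :: "real^'p"
    and K :: "(real^'p) set" and U :: "(real^'n) set"
    and x0 :: "real^'p"
  assumes "\<sigma> > 0" and "strongly_convex_with \<sigma> f"
    and "G \<noteq> 0"
    and "proper_cone K"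
    and "U \<noteq> {}" and "closed U" and "convex U"
    and "feasible_set G g K U \<noteq> {}"
    and "\<exists>xs\<in>dual_optimal_set f G g K U. dual_function f G g U xs = primal_value f G g K U"
    and "x0 \<in> dual_cone K"
  shows "\<exists>C1 C2 :: real. C1 > 0 \<and> C2 > 0 \<and>
    (\<forall>x y u. dfg_iterates f \<sigma> G g K U x0 x y u \<longrightarrow>
      (\<forall>\<epsilon>>0. \<forall>k\<ge>1. real k \<ge> C1 / sqrt \<epsilon> \<longrightarrow>
        average_iterate u k \<in> U \<and>
        infdist (G *v average_iterate u k + g) K \<le> C2 * \<epsilon> \<and>
        - (C2 * \<epsilon>) \<le> f (average_iterate u k) - primal_value f G g K U \<and>
        f (average_iterate u k) - primal_value f G g K U \<le> C2 * \<epsilon>))"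
proof -
  interpret strongly_convex_lagrangian f \<sigma> G g U
    using assms by unfold_locales
  have K: "convex_cone K" "closed K" using assms(4) by (auto simp: proper_cone_def)
  obtain xs where xs: "xs \<in> dual_optimal_set f G g K U" and fs: "dual xs = primal_value f G g K U"
    using assms(9) by blast
  define B where "B = (norm (xs - x0) + 1)\<^sup>2"
  \<comment> \<open>The sum dominates the three error bounds; the factor \<open>2\<close> comes from
    \<open>1 / (2 * (theta k)\<^sup>2) \<le> 2 / (real k)\<^sup>2\<close>.\<close>
  define C where "C = 2 * Ld * (B + norm xs * B + (norm x0)\<^sup>2)"
  have B: "B > 0" unfolding B_def by (intro zero_less_power add_nonneg_pos) auto
  have Cpos: "C > 0" unfolding C_def using Ld_pos B by (simp add: add_pos_nonneg)
  have main: "average_iterate u k \<in> U \<and>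
        infdist (G *v average_iterate u k + g) K \<le> C * \<epsilon> \<and>
        - (C * \<epsilon>) \<le> f (average_iterate u k) - primal_value f G g K U \<and>
        f (average_iterate u k) - primal_value f G g K U \<le> C * \<epsilon>"
    if dfg: "dfg_iterates f \<sigma> G g K U x0 x y u" and \<epsilon>: "\<epsilon> > 0" and k: "k \<ge> 1"
      and large: "real k \<ge> 1 / sqrt \<epsilon>" for x y u \<epsilon> k
  proof -
    let ?\<delta> = "Ld / (2 * (theta k)\<^sup>2)"
    have half: "theta k \<ge> real k / 2" using theta_lower_bound[of "k - 1"] k by (simp add: of_nat_diff)
    have "(1 / sqrt \<epsilon>)\<^sup>2 \<le> (real k)\<^sup>2" using large \<epsilon> by (intro power_mono) auto
    also have "\<dots> \<le> (2 * theta k)\<^sup>2" using half by (intro power_mono) auto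
    finally have "1 / \<epsilon> \<le> 4 * (theta k)\<^sup>2"
      using \<epsilon> by (simp add: power_divide power_mult_distrib)
    moreover have "(theta k)\<^sup>2 > 0" using half k by simp
    ultimately have "1 / (2 * (theta k)\<^sup>2) \<le> 2 * \<epsilon>" using \<epsilon> by (simp add: field_simps)
    then have "Ld * (1 / (2 * (theta k)\<^sup>2)) \<le> Ld * (2 * \<epsilon>)"
      using Ld_pos by (intro mult_left_mono) auto
    then have \<delta>: "?\<delta> \<le> 2 * Ld * \<epsilon>" by simp
    have bound: "?\<delta> * c \<le> C * \<epsilon>" if "0 \<le> c" "c \<le> B + norm xs * B + (norm x0)\<^sup>2" for c
    proof -
      have "?\<delta> * c \<le> (2 * Ld * \<epsilon>) * (B + norm xs * B + (norm x0)\<^sup>2)"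
        using that \<delta> Ld_pos \<epsilon> by (intro mult_mono) auto
      then show ?thesis unfolding C_def by (simp add: mult_ac)
    qed
    have 0: "0 \<le> norm xs * B" "0 \<le> (norm x0)\<^sup>2" using B by auto
    note gap = dfg_primal_gap[OF dfg assms(10) k K xs, folded B_def, unfolded fs]
    have "norm xs * (?\<delta> * B) = ?\<delta> * (norm xs * B)" by simp
    then show ?thesis
      using gap bound[of B] bound[of "norm xs * B"] bound[of "(norm x0)\<^sup>2"] 0 B
        average_iterate_in[OF dfg assms(10) k]
      by linarith
  qed
  show ?thesis
    using main Cpos by (intro exI[of _ 1] exI[of _ C]) auto
qed

end
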